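(* For $|q|<1$ let $$u_k := u_k(q) := \frac{2q^{k^2/9} f(q^{9+2k}, q^{9-2k})}{\varphi(q^9)}, \qquad k=1,\dots,4.$$ Then (i) $\dfrac{\varphi(q^{1/9})}{\varphi(q^9)} = 1+u_1+u_2+u_3+u_4$; (ii) $p := u_1u_2u_4 = \dfrac{8q^{7/3}\chi(q)}{\chi^6(q^9)\chi(q^3)}$; (iii) $u_3 = \dfrac{\varphi(q)}{\varphi(q^9)} - 1$. Furthermore, for $0<|q|<1$, for a suitable labeling $\alpha,\beta,\gamma$ of the roots of the cubic equation $$r(\xi) := \xi^3 - u_3\Big(\frac{\varphi^2(q)}{\varphi^2(q^9)}+3\Big)\big(\xi^2 - 2u_3^2\xi\big) - p^3 = 0$$ (and suitable determinations of the cube roots), one has $$u_1 = \Big(\frac{\beta p}{\alpha}\Big)^{1/3},\quad u_2 = \Big(\frac{\gamma p}{\beta}\Big)^{1/3},\quad u_4 = \Big(\frac{\alpha p}{\gamma}\Big)^{1/3}.$$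
   Context: Ramanujan's general theta function is $f(a,b) := \sum_{n=-\infty}^{\infty} a^{n(n+1)/2} b^{n(n-1)/2}$ for $|ab|<1$. Also $\varphi(q) := f(q,q) = \sum_{n=-\infty}^\infty q^{n^2}$ and $\chi(q) := (-q;q^2)_\infty = \prod_{k=0}^\infty (1+q^{2k+1})$ for $|q|<1$. Fractional powers of $q$ (such as $q^{1/9}$, $q^{k^2/9}$, $q^{7/3}$) are taken with a fixed consistent branch. *)

theory Defs
  imports "HOL-Analysis.Analysis"
begin

text \<open>
  The exponents \<open>n(n+1)/2\<close> and \<open>n(n-1)/2\<close> are nonnegative integers for every integer \<open>n\<close>,
  so neither \<open>div\<close> nor \<open>nat\<close> truncates. The convention \<open>0 ^ 0 = 1\<close> gives \<open>f(0,0) = 1\<close>.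
  The value is meaningful for \<open>|ab| < 1\<close>.
\<close>

definition theta_f :: "complex \<Rightarrow> complex \<Rightarrow> complex" where
  "theta_f a b = (\<Sum>\<^sub>\<infinity>n\<in>(UNIV :: int set). a ^ nat (n * (n + 1) div 2) * b ^ nat (n * (n - 1) div 2))"

definition theta_phi :: "complex \<Rightarrow> complex" where
  "theta_phi q = theta_f q q"

definition theta_chi :: "complex \<Rightarrow> complex" where
  "theta_chi q = (\<Prod>k. 1 + q ^ (2 * k + 1))"

text \<open>
  Fractional powers of \<open>q\<close>: the parameter \<open>t\<close> is the chosen value of \<open>q\<close> to the power \<open>1/9\<close> (so \<open>t ^ 9 = q\<close>),
  and \<open>q\<close> to the power \<open>m/9\<close> is then \<open>t ^ m\<close>; in particular \<open>q\<close> to the power \<open>7/3\<close> is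
  \<open>t ^ 21\<close>. The functions \<open>theta_u q t k\<close> are only used for \<open>1 \<le> k \<le> 4\<close>, where \<open>9 - 2 * k\<close> does not
  truncate.
\<close>

definition theta_u :: "complex \<Rightarrow> complex \<Rightarrow> nat \<Rightarrow> complex" where
  "theta_u q t k = 2 * t ^ (k\<^sup>2) * theta_f (q ^ (9 + 2 * k)) (q ^ (9 - 2 * k)) / theta_phi (q ^ 9)"

definition theta_p :: "complex \<Rightarrow> complex \<Rightarrow> complex" where
  "theta_p q t = theta_u q t 1 * theta_u q t 2 * theta_u q t 4"

definition theta_cubic :: "complex \<Rightarrow> complex \<Rightarrow> complex \<Rightarrow> complex" where
  "theta_cubic q t \<xi> = \<xi> ^ 3
     - theta_u q t 3 * ((theta_phi q)\<^sup>2 / (theta_phi (q ^ 9))\<^sup>2 + 3) * (\<xi>\<^sup>2 - 2 * (theta_u q t 3)\<^sup>2 * \<xi>)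
     - (theta_p q t) ^ 3"

end

(*
  Put T c = sum of t^(m^2) over the integers m with m = c mod 9, so that u_k = 2 T k / T 0. The roots are
  alpha = u_2 u_4^2, beta = u_1^2 u_4, gamma = u_1 u_2^2; what has to be shown is
    T2 T4^2 + T1^2 T4 + T1 T2^2 = T3 (T3^2 + T3 T0 + T0^2)  =: G,
    T1 T2 T4 (T1^2 T2 + T4^2 T1 + T2^2 T4) = T0 T3^2 G.
  Each of the three cubic sums is a sum of t^|v|^2 over vectors v in Z^3 with v_1 = v_2 = v_3 - 3 mod 9 and a
  prescribed residue of v_1 mod 3. Splitting v into its mean n and its part orthogonal to (1,1,1) factors
  such a sum into a theta series in t^3, depending only on the residue of n mod 3, and a binary theta
  series which is the same in all three cases. With Y and Z the theta series for n = 1 or 2 and for n = 0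
  mod 3, the first identity is immediate and the second reduces to T1 T2 T4 Z = T0 T3^2 Y, which, like the
  formula for p, follows from Jacobi's triple product.
*)
theory Submission
  imports Defs
begin

section \<open>Jacobi's triple product\<close>

definition tri :: "int \<Rightarrow> nat" where
  "tri j = nat (j * (j + 1) div 2)"

text \<open>A product of two consecutive integers is even and nonnegative, so nothing is truncated.
  Exponents are compared below in this doubled form, free of division.\<close>

lemma tri_eq: "2 * int (tri j) = j * (j + 1)"
proof -
  have "0 \<le> j * (j + 1)"
    by (cases "0 \<le> j") (auto intro: mult_nonneg_nonneg mult_nonpos_nonpos)
  moreover have "even (j * (j + 1))"
    by simp
  ultimately show ?thesis
    unfolding tri_def by (simp add: pos_imp_zdiv_nonneg_iff)
qed

lemma tri_eqI: "2 * int k = j * (j + 1) \<Longrightarrow> tri j = k"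
  using tri_eq[of j] by linarith

lemma tri_minus: "tri (- j) = tri (j - 1)"
  by (rule tri_eqI) (simp add: tri_eq algebra_simps)

definition theta_term :: "complex \<Rightarrow> complex \<Rightarrow> int \<Rightarrow> complex" where
  "theta_term a b j = a ^ tri j * b ^ tri (j - 1)"

lemma theta_f_eq: "theta_f a b = infsum (theta_term a b) UNIV"
  unfolding theta_f_def theta_term_def tri_def by (simp add: algebra_simps)

text \<open>Reflection exchanges the two exponents, so one-sided arguments transfer to the other
  side by swapping \<open>a\<close> and \<open>b\<close>.\<close>

lemma theta_term_minus: "theta_term a b (- j) = theta_term b a j"
  unfolding theta_term_def using tri_minus[of j] tri_minus[of "j + 1"]
  by (simp add: algebra_simps minus_diff_commute)

text \<open>Consecutive terms have ratio \<open>a * (a * b)\<close> to the power \<open>j\<close>,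
  up to the position of the first factor: \<open>a\<close> times the \<open>j\<close>-th power of
  \<open>a * b\<close>. Multiplying by the power \<open>n - j\<close> of \<open>a * b\<close> keeps
  all exponents natural, also for negative \<open>j\<close> and for
  \<open>a * b = 0\<close>.\<close>

lemma theta_term_shift:
  assumes "j \<le> int n"
  shows "a * (a * b) ^ n * theta_term a b j = (a * b) ^ nat (int n - j) * theta_term a b (j + 1)"
proof -
  have "int (n + 1 + tri j) = int (nat (int n - j) + tri (j + 1))"
    using assms tri_eq[of j] tri_eq[of "j + 1"] by (simp add: algebra_simps)
  hence 1: "n + 1 + tri j = nat (int n - j) + tri (j + 1)"
    by linarith
  have "int (n + tri (j - 1)) = int (nat (int n - j) + tri j)"
    using assms tri_eq[of j] tri_eq[of "j - 1"] by (simp add: algebra_simps)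
  hence 2: "n + tri (j - 1) = nat (int n - j) + tri j"
    by linarith
  have "a * (a * b) ^ n * theta_term a b j = a ^ (n + 1 + tri j) * b ^ (n + tri (j - 1))"
    by (simp add: theta_term_def power_mult_distrib power_add algebra_simps)
  also have "\<dots> = (a * b) ^ nat (int n - j) * theta_term a b (j + 1)"
    unfolding 1 2 by (simp add: theta_term_def power_mult_distrib power_add algebra_simps)
  finally show ?thesis .
qed

text \<open>The ratio \<open>a * h ^ k\<close> of consecutive terms tends to 0 however large
  \<open>a\<close> is, so the ratio test applies from some index on.\<close>

lemma summable_theta_term_nat:
  assumes "norm (a * b) < 1"
  shows "summable (\<lambda>k. norm (theta_term a b (int k)))"
proof -
  define h where "h = a * b"
  have rec: "theta_term a b (int (Suc k)) = a * h ^ k * theta_term a b (int k)" for k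
    using theta_term_shift[of "int k" k a b] by (simp add: h_def algebra_simps)
  have "(\<lambda>k. norm a * norm h ^ k) \<longlonglongrightarrow> norm a * 0"
    using assms by (intro tendsto_intros LIMSEQ_power_zero) (simp_all add: h_def)
  hence "eventually (\<lambda>k. norm a * norm h ^ k < 1 / 2) sequentially"
    by (intro order_tendstoD(2)) auto
  then obtain N where N: "norm a * norm h ^ k < 1 / 2" if "k \<ge> N" for k
    by (auto simp: eventually_sequentially)
  show ?thesis
  proof (rule summable_ratio_test[of "1 / 2" N])
    fix n assume "N \<le> n"
    hence "norm a * norm h ^ n * norm (theta_term a b (int n)) \<le> 1 / 2 * norm (theta_term a b (int n))"
      using N[of n] by (intro mult_right_mono) auto
    thus "norm (norm (theta_term a b (int (Suc n)))) \<le> 1 / 2 * norm (norm (theta_term a b (int n)))"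
      unfolding rec by (simp add: norm_mult norm_power)
  qed auto
qed

lemma abs_summable_theta_term:
  assumes "norm (a * b) < 1"
  shows "(\<lambda>j. norm (theta_term a b j)) summable_on UNIV"
proof -
  have nn: "(\<lambda>j. norm (theta_term a b j)) summable_on {0..}" if "norm (a * b) < 1" for a b
  proof -
    have "(\<lambda>k. norm (theta_term a b (int k))) summable_on UNIV"
      using summable_theta_term_nat[OF that] by (subst summable_on_UNIV_nonneg_real_iff) auto
    thus ?thesis
      by (subst (asm) summable_on_reindex_bij_witness[where j = int and i = nat and T = "{0..}"
            and h = "\<lambda>j. norm (theta_term a b j)"]) auto
  qed
  have "(\<lambda>j. norm (theta_term b a j)) summable_on {0..}"
    using nn[of b a] assms by (simp add: mult.commute)
  hence "(\<lambda>j. norm (theta_term a b j)) summable_on {..0}"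
    by (subst (asm) summable_on_reindex_bij_witness[where j = uminus and i = uminus and T = "{..0}"
          and h = "\<lambda>j. norm (theta_term a b j)"]) (auto simp: theta_term_minus)
  \<comment> \<open>Index 0 already belongs to the nonnegative half.\<close>
  hence "(\<lambda>j. norm (theta_term a b j)) summable_on {..<0}"
    by (rule summable_on_subset_banach) auto
  with nn[OF assms] have "(\<lambda>j. norm (theta_term a b j)) summable_on ({0..} \<union> {..<0})"
    by (intro summable_on_Un_disjoint) auto
  moreover have "{0..} \<union> {..<0} = (UNIV :: int set)"
    by auto
  ultimately show ?thesis
    by simp
qed

text \<open>
  In the usual notation \<open>qpoch h n\<close> is \<open>(h; h)\<^sub>n\<close>, \<open>euler h\<close> is \<open>(h; h)\<^sub>\<infinity>\<close>, \<open>qprod h a\<close> is \<open>(- a; h)\<^sub>\<infinity>\<close>, and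
  \<open>qbinom h i k\<close> is the Gaussian binomial coefficient of \<open>i + k\<close> over \<open>k\<close>.
\<close>

definition qpoch :: "complex \<Rightarrow> nat \<Rightarrow> complex" where
  "qpoch h n = (\<Prod>k<n. 1 - h ^ Suc k)"

definition qbinom :: "complex \<Rightarrow> nat \<Rightarrow> nat \<Rightarrow> complex" where
  "qbinom h i k = qpoch h (i + k) / (qpoch h i * qpoch h k)"

lemma one_minus_power_nonzero: "norm h < 1 \<Longrightarrow> 1 - (h :: complex) ^ Suc k \<noteq> 0"
  by (metis norm_one norm_power power_less_one_iff right_minus_eq zero_less_Suc norm_ge_zero
      less_irrefl power_Suc_less_one)

lemma qpoch_nonzero: "norm h < 1 \<Longrightarrow> qpoch h n \<noteq> 0"
  using one_minus_power_nonzero[of h] by (simp add: qpoch_def)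

lemma qpoch_Suc: "qpoch h (Suc n) = qpoch h n * (1 - h ^ Suc n)"
  by (simp add: qpoch_def)

lemma qbinom_0 [simp]:
  assumes "norm h < 1"
  shows "qbinom h 0 k = 1" "qbinom h i 0 = 1"
  using qpoch_nonzero[OF assms] by (simp_all add: qbinom_def, simp_all add: qpoch_def)

text \<open>The q-Pascal rule. After cancelling common factors it is
  \<open>1 - x * y = (1 - x) + x * (1 - y)\<close> for \<open>x = h ^ Suc i\<close> and
  \<open>y = h ^ Suc k\<close>.\<close>

lemma qbinom_Suc:
  assumes "norm h < 1"
  shows "qbinom h (Suc i) (Suc k) = qbinom h i (Suc k) + h ^ Suc i * qbinom h (Suc i) k"
proof -
  define x y where "x = h ^ Suc i" and "y = h ^ Suc k"
  have nz: "qpoch h i \<noteq> 0" "qpoch h k \<noteq> 0" "1 - x \<noteq> 0" "1 - y \<noteq> 0"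
    using qpoch_nonzero[OF assms] one_minus_power_nonzero[OF assms] by (simp_all only: x_def y_def not_False_eq_True)
  have 1: "qpoch h (Suc i) = qpoch h i * (1 - x)" "qpoch h (Suc k) = qpoch h k * (1 - y)"
    "qpoch h (Suc i + Suc k) = qpoch h (Suc (i + k)) * (1 - x * y)"
    by (simp_all add: qpoch_Suc x_def y_def power_add algebra_simps)
  show ?thesis
    unfolding qbinom_def 1 x_def [symmetric] using nz
    by (simp add: 1 divide_simps) (simp add: algebra_simps)
qed

section \<open>Finite form of Jacobi's triple product\<close>

definition theta_partial :: "complex \<Rightarrow> complex \<Rightarrow> nat \<Rightarrow> nat \<Rightarrow> complex" where
  "theta_partial a b n m =
     (\<Sum>j = - int m..int n. qbinom (a * b) (nat (int n - j)) (nat (int m + j)) * theta_term a b j)"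

lemma theta_partial_commute: "theta_partial a b n m = theta_partial b a m n"
  unfolding theta_partial_def
  by (rule sum.reindex_bij_witness[of _ uminus uminus])
     (auto simp: theta_term_minus qbinom_def algebra_simps)

text \<open>Multiplication by \<open>a * h ^ n\<close> shifts the index of the theta terms by one;
  the q-Pascal rule then merges the shifted sum with the original one.\<close>

lemma theta_partial_Suc:
  assumes h: "norm (a * b) < 1"
  shows "theta_partial a b (Suc n) m = theta_partial a b n m * (1 + a * (a * b) ^ n)"
proof -
  define h where "h = a * b"
  define c where "c = (\<lambda>n j. qbinom h (nat (int n - j)) (nat (int m + j)))"
  define t where "t = theta_term a b"
  have h1: "norm h < 1"
    using h by (simp add: h_def)
  \<comment> \<open>Both ends are left out: \<open>k\<close> would be -1 at
    \<open>j = - int m\<close>, and \<open>i\<close> would be -1 at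
    \<open>j = int n + 1\<close>.\<close>
  have pascal: "c (Suc n) j = c n j + h ^ nat (int n + 1 - j) * c n (j - 1)"
    if j: "j \<in> {- int m + 1..int n}" for j
  proof -
    obtain i k where ik: "int n - j = int i" "int m + j = int (Suc k)"
      using j by (intro that[of "nat (int n - j)" "nat (int m + j - 1)"]) auto
    have "nat (int (Suc n) - j) = Suc i" "nat (int n - j) = i" "nat (int m + j) = Suc k"
      "nat (int n - (j - 1)) = Suc i" "nat (int m + (j - 1)) = k" "nat (int n + 1 - j) = Suc i"
      using ik by auto
    thus ?thesis
      unfolding c_def using qbinom_Suc[OF h1] by simp
  qed
  have "theta_partial a b n m * (1 + a * h ^ n) =
      (\<Sum>j = - int m..int n. c n j * t j) + (\<Sum>j = - int m..int n. c n j * (a * h ^ n * t j))"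
    unfolding theta_partial_def c_def t_def h_def distrib_left sum_distrib_right mult_1_right
    by (simp only: mult_ac)
  also have "(\<Sum>j = - int m..int n. c n j * (a * h ^ n * t j)) =
      (\<Sum>j = - int m..int n. c n j * (h ^ nat (int n - j) * t (j + 1)))"
    unfolding h_def t_def by (intro sum.cong refl arg_cong2[where f = "(*)"] theta_term_shift) auto
  also have "\<dots> = (\<Sum>j = - int m + 1..int n + 1. h ^ nat (int n + 1 - j) * c n (j - 1) * t j)"
    by (rule sum.reindex_bij_witness[of _ "\<lambda>j. j - 1" "\<lambda>j. j + 1"]) auto
  \<comment> \<open>Each of the two sums loses one end term; the Gaussian coefficient there is 1,
    both before and after the step from \<open>n\<close> to \<open>Suc n\<close>.\<close>
  also have "{- int m + 1..int n + 1} = insert (int n + 1) {- int m + 1..int n}"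
    by auto
  also have "(\<Sum>j\<in>insert (int n + 1) {- int m + 1..int n}. h ^ nat (int n + 1 - j) * c n (j - 1) * t j) =
      t (int n + 1) + (\<Sum>j = - int m + 1..int n. h ^ nat (int n + 1 - j) * c n (j - 1) * t j)"
    by (subst sum.insert) (auto simp: c_def h1)
  also have "{- int m..int n} = insert (- int m) {- int m + 1..int n}"
    by auto
  also have "(\<Sum>j\<in>insert (- int m) {- int m + 1..int n}. c n j * t j) =
      t (- int m) + (\<Sum>j = - int m + 1..int n. c n j * t j)"
    by (subst sum.insert) (auto simp: c_def h1)
  also have "t (- int m) + (\<Sum>j = - int m + 1..int n. c n j * t j) +
      (t (int n + 1) + (\<Sum>j = - int m + 1..int n. h ^ nat (int n + 1 - j) * c n (j - 1) * t j)) =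
      t (- int m) + t (int n + 1) + (\<Sum>j = - int m + 1..int n. c (Suc n) j * t j)"
    by (simp add: pascal algebra_simps sum.distrib)
  also have "\<dots> = (\<Sum>j\<in>insert (- int m) (insert (int n + 1) {- int m + 1..int n}). c (Suc n) j * t j)"
    by (subst sum.insert, simp, simp, subst sum.insert) (auto simp: c_def h1)
  also have "insert (- int m) (insert (int n + 1) {- int m + 1..int n}) = {- int m..int (Suc n)}"
    by auto
  also have "(\<Sum>j = - int m..int (Suc n). c (Suc n) j * t j) = theta_partial a b (Suc n) m"
    by (simp add: theta_partial_def c_def t_def h_def)
  finally show ?thesis
    by (simp add: h_def)
qed

text \<open>One factor in \<open>a\<close> is added at a time; the factors in \<open>b\<close> come
  from the same recursion after exchanging \<open>a\<close> and \<open>b\<close>.\<close>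

lemma theta_partial_eq_prod:
  assumes "norm (a * b) < 1"
  shows "theta_partial a b n m = (\<Prod>k<n. 1 + a * (a * b) ^ k) * (\<Prod>k<m. 1 + b * (a * b) ^ k)"
proof (induction n)
  case 0
  have "theta_partial b a m 0 = (\<Prod>k<m. 1 + b * (a * b) ^ k)"
  proof (induction m)
    case 0
    show ?case
      using assms by (simp add: theta_partial_def theta_term_def tri_def mult.commute)
  next
    case (Suc m)
    thus ?case
      using theta_partial_Suc[of b a m 0] assms by (simp add: mult.commute)
  qed
  thus ?case
    by (simp add: theta_partial_commute[of a b])
next
  case (Suc n)
  thus ?case
    using theta_partial_Suc[OF assms] by simp
qed

section \<open>Infinite products and the passage to the limit\<close>

definition euler :: "complex \<Rightarrow> complex" where
  "euler h = (\<Prod>k. 1 - h ^ Suc k)"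

definition qprod :: "complex \<Rightarrow> complex \<Rightarrow> complex" where
  "qprod h a = (\<Prod>k. 1 + a * h ^ k)"

lemma convergent_qprod:
  assumes "norm h < 1"
  shows "convergent_prod (\<lambda>k. 1 + a * h ^ k :: complex)"
proof -
  have "summable (\<lambda>k. norm (1 + a * h ^ k - 1))"
    using assms by (simp add: norm_mult norm_power)
  thus ?thesis
    using abs_convergent_prod_conv_summable abs_convergent_prod_imp_convergent_prod by blast
qed

lemma qprod_LIMSEQ:
  assumes "norm h < 1"
  shows "(\<lambda>n. \<Prod>k<n. 1 + a * h ^ k) \<longlonglongrightarrow> qprod h a"
  using convergent_prod_LIMSEQ[OF convergent_qprod[OF assms, of a]]
  by (simp add: qprod_def LIMSEQ_lessThan_iff_atMost)

lemma euler_conv_qprod: "euler h = qprod h (- h)"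
  by (simp add: euler_def qprod_def)

lemma qpoch_LIMSEQ: "norm h < 1 \<Longrightarrow> qpoch h \<longlonglongrightarrow> euler h"
  using qprod_LIMSEQ[of h "- h"] unfolding euler_conv_qprod by (simp add: qpoch_def [abs_def])

lemma qprod_nonzero:
  assumes "norm h < 1" "norm a < 1"
  shows "qprod h a \<noteq> 0"
  unfolding qprod_def
proof (rule prodinf_nonzero[OF convergent_qprod[OF assms(1)]])
  fix k
  have "norm (a * h ^ k) < 1"
    using assms mult_left_le[of "norm h ^ k" "norm a"]
    by (simp add: norm_mult norm_power power_le_one)
  thus "1 + a * h ^ k \<noteq> 0"
    by (metis add_eq_0_iff norm_minus_cancel norm_one less_irrefl)
qed

lemma euler_nonzero: "norm h < 1 \<Longrightarrow> euler h \<noteq> 0"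
  by (simp add: euler_conv_qprod qprod_nonzero)

text \<open>For fixed \<open>j\<close> both indices and their sum tend to infinity, so one factor
  \<open>euler h\<close> cancels.\<close>

lemma qbinom_LIMSEQ:
  assumes "norm h < 1"
  shows "(\<lambda>n. qbinom h (nat (int n - j)) (nat (int n + j))) \<longlonglongrightarrow> 1 / euler h"
proof -
  have l: "filterlim (\<lambda>n. nat (int n + i)) sequentially sequentially" for i
    unfolding filterlim_at_top
  proof
    fix Z
    show "eventually (\<lambda>n. Z \<le> nat (int n + i)) sequentially"
      using eventually_ge_at_top[of "Z + nat \<bar>i\<bar>"] by eventually_elim linarith
  qed
  have "filterlim (\<lambda>n. nat (int n - j) + nat (int n + j)) sequentially sequentially"
    by (rule filterlim_at_top_mono[OF l[of j]]) simp
  hence "(\<lambda>n. qbinom h (nat (int n - j)) (nat (int n + j))) \<longlonglongrightarrow> euler h / (euler h * euler h)"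
    unfolding qbinom_def using euler_nonzero[OF assms] l[of "- j"] l[of j]
    by (intro tendsto_intros filterlim_compose[OF qpoch_LIMSEQ[OF assms]]) simp_all
  thus ?thesis
    using euler_nonzero[OF assms] by simp
qed

text \<open>Supplies the dominating constant for Tannery's theorem: \<open>qpoch h\<close> has a
  nonzero limit, so it and its inverse are bounded.\<close>

lemma qbinom_bounded:
  assumes "norm h < 1"
  obtains K where "\<And>i k. norm (qbinom h i k) \<le> K"
proof -
  have "Bseq (qpoch h)"
    using qpoch_LIMSEQ[OF assms] by (intro convergent_imp_Bseq) (auto simp: convergent_def)
  then obtain A where A: "norm (qpoch h n) \<le> A" "A > 0" for n
    by (auto simp: Bseq_def)
  have "Bseq (\<lambda>n. inverse (qpoch h n))"
    using tendsto_inverse[OF qpoch_LIMSEQ[OF assms] euler_nonzero[OF assms]]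
    by (intro convergent_imp_Bseq) (auto simp: convergent_def)
  then obtain B where B: "norm (inverse (qpoch h n)) \<le> B" "B > 0" for n
    by (auto simp: Bseq_def)
  have "norm (qbinom h i k) \<le> A * (B * B)" for i k
  proof -
    have "norm (qbinom h i k) =
        norm (qpoch h (i + k)) * (norm (inverse (qpoch h i)) * norm (inverse (qpoch h k)))"
      by (simp add: qbinom_def norm_divide norm_mult norm_inverse divide_simps)
    also have "\<dots> \<le> A * (B * B)"
      using A B by (intro mult_mono) (auto simp: less_imp_le)
    finally show ?thesis .
  qed
  thus ?thesis
    by (rule that)
qed

text \<open>Tannery's theorem concerns series over the naturals; absolute convergence permits
  enumerating the integers by \<open>int_decode\<close>.\<close>

lemma infsum_int_decode:
  fixes f :: "int \<Rightarrow> complex"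
  assumes "(\<lambda>j. norm (f j)) summable_on UNIV"
  shows "summable (\<lambda>k. norm (f (int_decode k)))" "infsum f UNIV = (\<Sum>k. f (int_decode k))"
proof -
  have b: "bij_betw int_decode UNIV UNIV"
    by (rule bij_int_decode)
  have "(\<lambda>k. norm (f (int_decode k))) summable_on UNIV"
    using summable_on_reindex_bij_betw[OF b, of "\<lambda>j. norm (f j)"] assms by simp
  thus s: "summable (\<lambda>k. norm (f (int_decode k)))"
    by (subst (asm) summable_on_UNIV_nonneg_real_iff) auto
  have "infsum f UNIV = infsum (\<lambda>k. f (int_decode k)) UNIV"
    using infsum_reindex_bij_betw[OF b, of f] by simp
  also have "\<dots> = (\<Sum>k. f (int_decode k))"
    by (intro infsumI norm_summable_imp_has_sum s summable_sums summable_norm_cancel[OF s])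
  finally show "infsum f UNIV = (\<Sum>k. f (int_decode k))" .
qed

text \<open>Let \<open>n = m\<close> tend to infinity in the finite form: the products converge, and
  Tannery's theorem gives the limit of the sums, dominated by a multiple of the theta terms.\<close>

lemma jacobi_triple_product:
  assumes "norm (a * b) < 1"
  shows "theta_f a b = qprod (a * b) a * qprod (a * b) b * euler (a * b)"
proof -
  define h where "h = a * b"
  have h: "norm h < 1"
    using assms by (simp add: h_def)
  \<comment> \<open>Outside \<open>{- int n..int n}\<close> one argument of \<open>qbinom\<close>
    would truncate to 0 and give coefficient 1, hence the explicit 0.\<close>
  define c where "c = (\<lambda>n j. if j \<in> {- int n..int n}
                              then qbinom h (nat (int n - j)) (nat (int n + j)) else 0)"
  define t where "t = theta_term a b"
  have t: "(\<lambda>j. norm (t j)) summable_on UNIV"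
    unfolding t_def by (rule abs_summable_theta_term[OF assms])
  obtain K where K: "\<And>i k. norm (qbinom h i k) \<le> K"
    using qbinom_bounded[OF h] by blast
  have "0 \<le> K"
    using K[of 0 0] norm_ge_zero order_trans by blast
  have cK: "norm (c n j * t j) \<le> K * norm (t j)" for n j
    unfolding norm_mult using K \<open>0 \<le> K\<close> by (intro mult_right_mono) (simp_all add: c_def)
  have lim: "(\<lambda>n. c n j * t j) \<longlonglongrightarrow> 1 / euler h * t j" for j
  proof -
    have "eventually (\<lambda>n. qbinom h (nat (int n - j)) (nat (int n + j)) = c n j) sequentially"
      using eventually_ge_at_top[of "nat \<bar>j\<bar>"] by eventually_elim (auto simp: c_def)
    from Lim_transform_eventually[OF qbinom_LIMSEQ[OF h] this]
    show ?thesis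
      by (intro tendsto_intros)
  qed
  have partial: "(\<Sum>k. c n (int_decode k) * t (int_decode k)) = theta_partial a b n n" for n
  proof -
    have hs: "((\<lambda>j. c n j * t j) has_sum theta_partial a b n n) UNIV"
      by (rule has_sum_finite_neutralI[of "{- int n..int n}"])
         (auto simp: theta_partial_def c_def t_def h_def)
    hence "(\<lambda>j. norm (c n j * t j)) summable_on UNIV"
      unfolding summable_on_iff_abs_summable_on_complex [symmetric] by (rule has_sum_imp_summable)
    from infsum_int_decode(2)[OF this] show ?thesis
      using infsumI[OF hs] by simp
  qed
  have "(\<lambda>n. \<Sum>k. c n (int_decode k) * t (int_decode k)) \<longlonglongrightarrow>
      (\<Sum>k. 1 / euler h * t (int_decode k))"
  proof (rule tannerys_theorem[THEN conjunct2, THEN conjunct2])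
    show "eventually (\<lambda>(k, n). norm (c n (int_decode k) * t (int_decode k)) \<le>
            K * norm (t (int_decode k))) (sequentially \<times>\<^sub>F sequentially)"
      using cK by (intro always_eventually) auto
    show "summable (\<lambda>k. K * norm (t (int_decode k)))"
      by (intro summable_mult infsum_int_decode(1)[OF t])
  qed (use lim in auto)
  hence "(\<lambda>n. theta_partial a b n n) \<longlonglongrightarrow> 1 / euler h * theta_f a b"
    unfolding partial theta_f_eq t_def [symmetric] infsum_int_decode(2)[OF t]
    by (subst (asm) suminf_mult) (use infsum_int_decode(1)[OF t] in \<open>auto intro: summable_norm_cancel\<close>)
  moreover have "(\<lambda>n. theta_partial a b n n) \<longlonglongrightarrow> qprod h a * qprod h b"
    unfolding theta_partial_eq_prod[OF assms] using qprod_LIMSEQ[OF h]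
    by (auto simp: h_def intro!: tendsto_mult)
  ultimately have "1 / euler h * theta_f a b = qprod h a * qprod h b"
    by (rule LIMSEQ_unique)
  thus ?thesis
    using euler_nonzero[OF h] by (simp add: h_def divide_simps mult_ac)
qed

section \<open>Sums of squares in residue classes\<close>

definition square_theta :: "complex \<Rightarrow> int set \<Rightarrow> complex" where
  "square_theta s A = infsum (\<lambda>m. s ^ nat (m\<^sup>2)) A"

text \<open>Two consecutive triangular numbers add up to a square.\<close>

lemma theta_term_diag: "theta_term s s m = s ^ nat (m\<^sup>2)"
proof -
  have "int (tri m + tri (m - 1)) = int (nat (m\<^sup>2))"
    using tri_eq[of m] tri_eq[of "m - 1"] by (simp add: power2_eq_square algebra_simps)
  thus ?thesis
    unfolding theta_term_def power_add [symmetric] by (simp only: of_nat_eq_iff)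
qed

lemma abs_summable_squares:
  assumes "norm s < 1"
  shows "(\<lambda>m. norm (s ^ nat (m\<^sup>2) :: complex)) summable_on A"
proof -
  have "norm (s * s) < 1"
    using assms mult_strict_mono[of "norm s" 1 "norm s" 1] by (simp add: norm_mult)
  hence "(\<lambda>m. norm (theta_term s s m)) summable_on UNIV"
    by (rule abs_summable_theta_term)
  thus ?thesis
    unfolding theta_term_diag by (rule summable_on_subset_banach) simp
qed

lemma square_theta_has_sum:
  assumes "norm s < 1"
  shows "((\<lambda>m. s ^ nat (m\<^sup>2)) has_sum square_theta s A) A"
  unfolding square_theta_def using abs_summable_squares[OF assms, of A]
  unfolding summable_on_iff_abs_summable_on_complex [symmetric] by (rule has_sum_infsum)

text \<open>Squares do not see the sign; this identifies the classes \<open>i\<close> and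
  \<open>9 - i\<close> modulo 9 later on.\<close>

lemma square_theta_uminus:
  "square_theta s {m. m mod n = (- i) mod n} = square_theta s {m. m mod n = i mod n}"
  unfolding square_theta_def
proof (rule infsum_reindex_bij_witness[of _ uminus uminus])
  fix m
  show "- m \<in> {m. m mod n = i mod n}" if "m \<in> {m. m mod n = (- i) mod n}"
    using mod_minus_cong[of m n "- i"] that by simp
  show "- m \<in> {m. m mod n = (- i) mod n}" if "m \<in> {m. m mod n = i mod n}"
    using mod_minus_cong[of m n i] that by simp
qed simp_all

lemma square_theta_fibres:
  assumes "norm s < 1" "finite I"
  shows "square_theta s {m. f m \<in> I} = (\<Sum>i\<in>I. square_theta s {m. f m = i})"
  using assms(2)
proof induction
  case empty
  show ?case
    by (simp add: square_theta_def)
next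
  case (insert i I)
  have "((\<lambda>m. s ^ nat (m\<^sup>2)) has_sum
      (square_theta s {m. f m = i} + square_theta s {m. f m \<in> I})) ({m. f m = i} \<union> {m. f m \<in> I})"
    using insert by (intro has_sum_Un_disjoint square_theta_has_sum assms) auto
  also have "{m. f m = i} \<union> {m. f m \<in> I} = {m. f m \<in> insert i I}"
    by auto
  finally have "square_theta s {m. f m \<in> insert i I} =
      square_theta s {m. f m = i} + square_theta s {m. f m \<in> I}"
    unfolding square_theta_def[of _ "{m. f m \<in> insert i I}"] by (rule infsumI)
  thus ?case
    using insert by simp
qed

text \<open>The square of \<open>m * n + k\<close> is \<open>k^2\<close> plus
  \<open>m^2 + 2 k m\<close> times \<open>n(n+1)/2\<close> plus \<open>m^2 - 2 k m\<close> times
  \<open>n(n-1)/2\<close>. The bound \<open>2 * k \<le> m\<close> keeps the last coefficient from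
  truncating.\<close>

lemma square_theta_residue:
  assumes "0 < m" "2 * k \<le> m"
  shows "square_theta s {j. j mod int m = int k mod int m} =
         s ^ (k\<^sup>2) * theta_f (s ^ (m\<^sup>2 + 2 * k * m)) (s ^ (m\<^sup>2 - 2 * k * m))"
proof -
  have le: "2 * k * m \<le> m\<^sup>2"
    using assms by (simp add: power2_eq_square)
  have "square_theta s {j. j mod int m = int k mod int m} =
      infsum (\<lambda>n. s ^ (k\<^sup>2) * theta_term (s ^ (m\<^sup>2 + 2 * k * m)) (s ^ (m\<^sup>2 - 2 * k * m)) n) UNIV"
    unfolding square_theta_def
  proof (rule infsum_reindex_bij_witness[of _ "\<lambda>j. (j - int k) div int m" "\<lambda>n. int m * n + int k", symmetric])
    fix n
    have "int (k\<^sup>2 + ((m\<^sup>2 + 2 * k * m) * tri n + (m\<^sup>2 - 2 * k * m) * tri (n - 1))) =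
        (int k)\<^sup>2 + (((int m)\<^sup>2 + 2 * int k * int m) * int (tri n)
          + ((int m)\<^sup>2 - 2 * int k * int m) * int (tri (n - 1)))"
      using le by (simp add: of_nat_diff)
    also have "2 * \<dots> = 2 * (int k)\<^sup>2 + (((int m)\<^sup>2 + 2 * int k * int m) * (2 * int (tri n))
          + ((int m)\<^sup>2 - 2 * int k * int m) * (2 * int (tri (n - 1))))"
      by (simp add: algebra_simps)
    also have "\<dots> = 2 * (int m * n + int k)\<^sup>2"
      unfolding tri_eq by (simp add: power2_eq_square algebra_simps)
    finally have "nat ((int m * n + int k)\<^sup>2) =
        k\<^sup>2 + ((m\<^sup>2 + 2 * k * m) * tri n + (m\<^sup>2 - 2 * k * m) * tri (n - 1))"
      by (metis mult_cancel_left nat_int zero_neq_numeral)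
    thus "s ^ nat ((int m * n + int k)\<^sup>2) =
        s ^ k\<^sup>2 * theta_term (s ^ (m\<^sup>2 + 2 * k * m)) (s ^ (m\<^sup>2 - 2 * k * m)) n"
      by (simp add: theta_term_def power_add power_mult)
  next
    fix j assume "j \<in> {j. j mod int m = int k mod int m}"
    hence "int m dvd j - int k"
      unfolding mem_Collect_eq mod_eq_dvd_iff .
    thus "int m * ((j - int k) div int m) + int k = j"
      by simp
  qed (use assms in auto)
  thus ?thesis
    by (simp add: theta_f_eq infsum_cmult_right')
qed

section \<open>Products of series and cubic theta sums\<close>

lemma has_sum_product:
  fixes f :: "'a \<Rightarrow> complex" and g :: "'b \<Rightarrow> complex"
  assumes "(f has_sum a) A" "(g has_sum b) B"
  shows "((\<lambda>(x, y). f x * g y) has_sum (a * b)) (A \<times> B)"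
proof (rule has_sum_SigmaI)
  show "((\<lambda>y. case (x, y) of (x, y) \<Rightarrow> f x * g y) has_sum f x * b) B" for x
    using has_sum_cmult_right[OF assms(2)] by simp
  show "((\<lambda>x. f x * b) has_sum a * b) A"
    using has_sum_cmult_left[OF assms(1)] .
  \<comment> \<open>Summability of a complex family is absolute, so the double family is handled
    through its norms.\<close>
  have "(\<lambda>(x, y). norm (f x) * norm (g y)) summable_on A \<times> B"
  proof (rule summable_on_SigmaI)
    have "(\<lambda>y. norm (g y)) summable_on B" "(\<lambda>x. norm (f x)) summable_on A"
      unfolding summable_on_iff_abs_summable_on_complex [symmetric]
      using assms has_sum_imp_summable by blast+
    thus "((\<lambda>y. case (x, y) of (x, y) \<Rightarrow> norm (f x) * norm (g y)) has_sum
            norm (f x) * infsum (\<lambda>y. norm (g y)) B) B"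
      "(\<lambda>x. norm (f x) * infsum (\<lambda>y. norm (g y)) B) summable_on A" for x
      by (auto intro!: has_sum_cmult_right summable_on_cmult_left)
  qed auto
  thus "(\<lambda>(x, y). f x * g y) summable_on A \<times> B"
    unfolding summable_on_iff_abs_summable_on_complex by (simp add: case_prod_unfold norm_mult)
qed

text \<open>The exponent is the squared length of \<open>(x, y, - x - y)\<close> in the plane
  orthogonal to (1,1,1). The congruences are those of the deviations from the mean in the cubic sums
  below.\<close>

definition hexagonal_theta :: "complex \<Rightarrow> complex" where
  "hexagonal_theta s = infsum (\<lambda>(x, y). s ^ nat (x\<^sup>2 + y\<^sup>2 + (x + y)\<^sup>2))
     {(x, y). y mod 9 = x mod 9 \<and> x mod 3 = 2}"

text \<open>Dropping \<open>(x + y)^2\<close> from the exponent gives a dominating product of two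
  square series.\<close>

lemma hexagonal_theta_has_sum:
  assumes "norm s < 1"
  shows "((\<lambda>(x, y). s ^ nat (x\<^sup>2 + y\<^sup>2 + (x + y)\<^sup>2)) has_sum hexagonal_theta s)
     {(x, y). y mod 9 = x mod 9 \<and> x mod 3 = 2}"
proof -
  have "(\<lambda>(x, y). s ^ nat (x\<^sup>2) * s ^ nat (y\<^sup>2)) summable_on UNIV \<times> UNIV"
    using has_sum_product[OF square_theta_has_sum[OF assms] square_theta_has_sum[OF assms]]
    by (rule has_sum_imp_summable)
  hence "(\<lambda>p. norm (case p of (x, y) \<Rightarrow> s ^ nat (x\<^sup>2) * s ^ nat (y\<^sup>2))) summable_on UNIV"
    unfolding summable_on_iff_abs_summable_on_complex by simp
  hence "(\<lambda>p. norm (case p of (x, y) \<Rightarrow> s ^ nat (x\<^sup>2 + y\<^sup>2 + (x + y)\<^sup>2))) summable_on UNIV"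
  proof (rule summable_on_comparison_test)
    fix p :: "int \<times> int"
    show "norm (case p of (x, y) \<Rightarrow> s ^ nat (x\<^sup>2 + y\<^sup>2 + (x + y)\<^sup>2)) \<le>
        norm (case p of (x, y) \<Rightarrow> s ^ nat (x\<^sup>2) * s ^ nat (y\<^sup>2))"
      using assms
      by (cases p) (auto simp: norm_power power_add [symmetric] nat_add_distrib [symmetric]
          intro!: power_decreasing nat_mono)
  qed auto
  hence "(\<lambda>(x, y). s ^ nat (x\<^sup>2 + y\<^sup>2 + (x + y)\<^sup>2)) summable_on UNIV"
    unfolding summable_on_iff_abs_summable_on_complex .
  hence "(\<lambda>(x, y). s ^ nat (x\<^sup>2 + y\<^sup>2 + (x + y)\<^sup>2)) summable_on
      {(x, y). y mod 9 = x mod 9 \<and> x mod 3 = 2}"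
    by (rule summable_on_subset_banach) simp
  thus ?thesis
    unfolding hexagonal_theta_def by (rule has_sum_infsum)
qed

text \<open>
  The vector \<open>(n + x, n + y, n - x - y)\<close> has squared length \<open>3 n\<^sup>2 + x\<^sup>2 + y\<^sup>2 + (x + y)\<^sup>2\<close>. The congruences
  imposed on \<open>(x, y)\<close> do not involve \<open>c\<close>.
\<close>

lemma cubic_theta_sum:
  fixes s :: complex and c :: int
  assumes s: "norm s < 1"
  defines "T \<equiv> \<lambda>i. square_theta s {m. m mod 9 = i mod 9}"
  shows "T c * (T c * T (c + 3)) + T (c + 3) * (T (c + 3) * T (c + 6)) + T (c + 6) * (T (c + 6) * T (c + 9)) =
         square_theta (s ^ 3) {n. n mod 3 = (c + 1) mod 3} * hexagonal_theta s"
proof -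
  define W where "W = (\<lambda>i::int. {m. m mod 9 = i mod 9})"
  \<comment> \<open>The last two congruences are stated relative to \<open>x\<close>, so the union
    over \<open>c\<close>, \<open>c + 3\<close>, \<open>c + 6\<close> only relaxes the condition on
    \<open>x\<close> to one modulo 3.\<close>
  define V where "V = (\<lambda>i::int. {(x, y, z). x mod 9 = i mod 9 \<and> y mod 9 = x mod 9 \<and> z mod 9 = (x + 3) mod 9})"
  define g where "g = (\<lambda>(x, y, z). s ^ nat (x\<^sup>2) * (s ^ nat (y\<^sup>2) * s ^ nat (z\<^sup>2)))"
  define N where "N = {n. n mod 3 = (c + 1) mod 3}"
  define S where "S = {(x, y). y mod 9 = x mod 9 \<and> x mod 3 = (2::int)}"
  have V_eq: "V i = W i \<times> W i \<times> W (i + 3)" for i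
  proof -
    have "y mod 9 = x mod 9 \<and> z mod 9 = (x + 3) mod 9 \<longleftrightarrow>
        y mod 9 = i mod 9 \<and> z mod 9 = (i + 3) mod 9" if "x mod 9 = i mod 9" for x y z
      by (simp only: that mod_add_cong[OF that refl])
    hence "(x, y, z) \<in> V i \<longleftrightarrow> (x, y, z) \<in> W i \<times> W i \<times> W (i + 3)" for x y z
      unfolding V_def W_def mem_Collect_eq mem_Times_iff fst_conv snd_conv prod.case by blast
    thus ?thesis
      by (simp only: set_eq_iff split_paired_All simp_thms)
  qed
  have V: "(g has_sum (T i * (T i * T (i + 3)))) (V i)" for i
    using has_sum_product[OF square_theta_has_sum[OF s, of "W i"]
        has_sum_product[OF square_theta_has_sum[OF s, of "W i"] square_theta_has_sum[OF s, of "W (i + 3)"]]]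
    unfolding V_eq g_def T_def W_def by (simp add: case_prod_unfold)
  have c9: "c mod 9 \<noteq> (c + 3) mod 9" "c mod 9 \<noteq> (c + 6) mod 9" "(c + 3) mod 9 \<noteq> (c + 6) mod 9"
    by (simp_all add: mod_eq_dvd_iff)
  have V_disjoint: "V i \<inter> V j = {}" if "i mod 9 \<noteq> j mod 9" for i j
  proof -
    have "W i \<inter> W j = {}"
      unfolding W_def using that by fastforce
    thus ?thesis
      unfolding V_eq by (simp only: Times_Int_Times Times_empty simp_thms)
  qed
  have c3: "x mod 3 = c mod 3 \<longleftrightarrow> x mod 9 = c mod 9 \<or> x mod 9 = (c + 3) mod 9 \<or> x mod 9 = (c + 6) mod 9"
    for x
  proof -
    have "3 dvd d \<longleftrightarrow> 9 dvd d \<or> 9 dvd d - 3 \<or> 9 dvd d - 6" for d :: int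
      by presburger
    from this[of "x - c"] show ?thesis
      by (simp add: mod_eq_dvd_iff diff_diff_eq)
  qed
  have "(g has_sum (T c * (T c * T (c + 3)) + T (c + 3) * (T (c + 3) * T (c + 6)) +
      T (c + 6) * (T (c + 6) * T (c + 9)))) (V c \<union> V (c + 3) \<union> V (c + 6))"
  proof (intro has_sum_Un_disjoint)
    show "V c \<inter> V (c + 3) = {}" "(V c \<union> V (c + 3)) \<inter> V (c + 6) = {}"
      using c9[THEN V_disjoint] by (simp_all only: Int_Un_distrib2 Un_empty_left)
  qed (use V[of c] V[of "c + 3"] V[of "c + 6"] in \<open>simp_all add: algebra_simps\<close>)
  moreover have "V c \<union> V (c + 3) \<union> V (c + 6) =
      {(x, y, z). x mod 3 = c mod 3 \<and> y mod 9 = x mod 9 \<and> z mod 9 = (x + 3) mod 9}" (is "_ = ?U")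
  proof -
    have "(x, y, z) \<in> V c \<union> V (c + 3) \<union> V (c + 6) \<longleftrightarrow> (x, y, z) \<in> ?U" for x y z
      unfolding V_def Un_iff mem_Collect_eq prod.case using c3[of x] by blast
    thus ?thesis
      by (simp only: set_eq_iff split_paired_All simp_thms)
  qed
  ultimately have "(g has_sum (T c * (T c * T (c + 3)) + T (c + 3) * (T (c + 3) * T (c + 6)) +
      T (c + 6) * (T (c + 6) * T (c + 9)))) ?U"
    by simp
  moreover have "((\<lambda>(n, x, y). (s ^ 3) ^ nat (n\<^sup>2) * s ^ nat (x\<^sup>2 + y\<^sup>2 + (x + y)\<^sup>2)) has_sum
      square_theta (s ^ 3) N * hexagonal_theta s) (N \<times> S)"
  proof -
    have "norm (s ^ 3) < 1"
      using s by (simp add: norm_power power_less_one_iff)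
    from has_sum_product[OF square_theta_has_sum[OF this, of N] hexagonal_theta_has_sum[OF s]]
    show ?thesis
      unfolding S_def by (simp add: case_prod_unfold)
  qed
  hence "(g has_sum (square_theta (s ^ 3) N * hexagonal_theta s)) ?U"
  proof (subst has_sum_reindex_bij_witness[where T = "N \<times> S"
        and i = "\<lambda>(n, x, y). (n + x, n + y, n - x - y)"
        and j = "\<lambda>(x, y, z). ((x + y + z) div 3, x - (x + y + z) div 3, y - (x + y + z) div 3)"
        and h = "\<lambda>(n, x, y). (s ^ 3) ^ nat (n\<^sup>2) * s ^ nat (x\<^sup>2 + y\<^sup>2 + (x + y)\<^sup>2)"])
    fix p assume "p \<in> ?U"
    then obtain x y z where p: "p = (x, y, z)" and
      xyz: "x mod 3 = c mod 3" "y mod 9 = x mod 9" "z mod 9 = (x + 3) mod 9"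
      by auto
    obtain u where y: "y = x + 9 * u"
      using mod_eqE[OF xyz(2) [symmetric]] .
    obtain v where z: "z = x + 3 + 9 * v"
      using mod_eqE[OF xyz(3) [symmetric]] .
    \<comment> \<open>The mean is an integer congruent to \<open>x + 1\<close> modulo 3. This fixes
      its own class and forces \<open>x - n\<close> to be 2 modulo 3 whatever \<open>c\<close>
      is.\<close>
    define n where "n = (x + y + z) div 3"
    have n': "n = x + 1 + 3 * (u + v)"
      unfolding n_def y z by simp
    have n: "x + y + z = 3 * n"
      unfolding n' y z by simp
    show "(case case p of (x, y, z) \<Rightarrow> ((x + y + z) div 3, x - (x + y + z) div 3, y - (x + y + z) div 3) of
            (n, x, y) \<Rightarrow> (n + x, n + y, n - x - y)) = p"
      unfolding p using n by (simp add: n_def [symmetric])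
    have "n mod 3 = (c + 1) mod 3"
      unfolding n' mod_mult_self2 using xyz(1) by (rule mod_add_cong) simp
    moreover have "(x - n) mod 3 = 2"
      unfolding n' by presburger
    moreover have "(y - n) mod 9 = (x - n) mod 9"
      using xyz(2) by (rule mod_diff_cong) simp
    ultimately
    show "(case p of (x, y, z) \<Rightarrow> ((x + y + z) div 3, x - (x + y + z) div 3, y - (x + y + z) div 3)) \<in> N \<times> S"
      unfolding p by (simp add: n_def [symmetric] N_def S_def)
    \<comment> \<open>The three deviations from the mean sum to 0, so the mixed terms of the squared
      length cancel.\<close>
    have z: "z = 3 * n - x - y"
      using n by simp
    have "int (nat (x\<^sup>2) + (nat (y\<^sup>2) + nat (z\<^sup>2))) =
        int (3 * nat (n\<^sup>2) + nat ((x - n)\<^sup>2 + (y - n)\<^sup>2 + (x - n + (y - n))\<^sup>2))"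
      unfolding z of_nat_add of_nat_mult of_nat_numeral
      by (simp only: int_nat_eq zero_le_power2 add_nonneg_nonneg if_True)
         (simp add: power2_eq_square algebra_simps)
    hence "nat (x\<^sup>2) + (nat (y\<^sup>2) + nat (z\<^sup>2)) =
        3 * nat (n\<^sup>2) + nat ((x - n)\<^sup>2 + (y - n)\<^sup>2 + (x - n + (y - n))\<^sup>2)"
      by (simp only: of_nat_eq_iff)
    thus "(case case p of (x, y, z) \<Rightarrow> ((x + y + z) div 3, x - (x + y + z) div 3, y - (x + y + z) div 3) of
            (n, x, y) \<Rightarrow> (s ^ 3) ^ nat (n\<^sup>2) * s ^ nat (x\<^sup>2 + y\<^sup>2 + (x + y)\<^sup>2)) = g p"
      unfolding p g_def by (simp add: n_def [symmetric] power_add [symmetric] power_mult [symmetric])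
  next
    fix p assume "p \<in> N \<times> S"
    then obtain n x y where p: "p = (n, x, y)" and
      nxy: "n mod 3 = (c + 1) mod 3" "y mod 9 = x mod 9" "x mod 3 = 2"
      by (auto simp: N_def S_def)
    show "(case case p of (n, x, y) \<Rightarrow> (n + x, n + y, n - x - y) of
            (x, y, z) \<Rightarrow> ((x + y + z) div 3, x - (x + y + z) div 3, y - (x + y + z) div 3)) = p"
      unfolding p by simp
    obtain w where x: "x = 2 + 3 * w"
      using mod_eqE[of 2 3 x] nxy(3) by auto
    have "(n + x) mod 3 = (c + 1 + 2) mod 3"
      by (rule mod_add_cong) (use nxy in simp_all)
    hence 1: "(n + x) mod 3 = c mod 3"
      by simp
    have 2: "(n + y) mod 9 = (n + x) mod 9"
      using refl nxy(2) by (rule mod_add_cong)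
    \<comment> \<open>As \<open>x\<close> is 2 modulo 3, \<open>3 * x\<close> is 6 modulo 9, so
      \<open>- 2 * x\<close> is congruent to \<open>x + 3\<close>.\<close>
    have "(n - x - y) mod 9 = (n - x - x) mod 9"
      using refl nxy(2) by (rule mod_diff_cong)
    also have "n - x - x = n + x + 3 + 9 * (- w - 1)"
      unfolding x by simp
    finally have 3: "(n - x - y) mod 9 = (n + x + 3) mod 9"
      by (simp only: mod_mult_self2)
    show "(case p of (n, x, y) \<Rightarrow> (n + x, n + y, n - x - y)) \<in> ?U"
      unfolding p prod.case mem_Collect_eq using 1 2 3 by blast
  qed auto
  ultimately show ?thesis
    unfolding N_def by (rule has_sum_unique)
qed

text \<open>Factors are sorted by \<open>k\<close> modulo 3. This brings products to bases
  \<open>q ^ 2\<close> and \<open>q ^ 6\<close> down to the common base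
  \<open>q ^ 18\<close>.\<close>

lemma qprod_trisect:
  assumes "norm h < 1"
  shows "qprod h a = qprod (h ^ 3) a * qprod (h ^ 3) (a * h) * qprod (h ^ 3) (a * h\<^sup>2)"
proof -
  have h3: "norm (h ^ 3) < 1"
    using assms by (simp add: norm_power power_less_one_iff)
  have "(\<Prod>k<n. 1 + a * (h ^ 3) ^ k) * (\<Prod>k<n. 1 + a * h * (h ^ 3) ^ k) * (\<Prod>k<n. 1 + a * h\<^sup>2 * (h ^ 3) ^ k)
      = (\<Prod>k<n * 3. 1 + a * h ^ k)" for n
  proof (induction n)
    case (Suc n)
    have "Suc n * 3 = Suc (Suc (Suc (n * 3)))"
      by simp
    hence "(\<Prod>k<Suc n * 3. 1 + a * h ^ k) = (\<Prod>k<n * 3. 1 + a * h ^ k) *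
        ((1 + a * h ^ (3 * n)) * (1 + a * h ^ (1 + 3 * n)) * (1 + a * h ^ (2 + 3 * n)))"
      by (simp only: prod.lessThan_Suc) (simp add: mult_ac)
    also have "\<dots> = (\<Prod>k<n * 3. 1 + a * h ^ k) * ((1 + a * (h ^ 3) ^ n) *
        (1 + a * h * (h ^ 3) ^ n) * (1 + a * h\<^sup>2 * (h ^ 3) ^ n))"
      by (simp add: power_add power_mult mult.assoc power2_eq_square)
    finally show ?case
      unfolding Suc [symmetric] by (simp only: prod.lessThan_Suc mult_ac)
  qed simp
  hence "(\<lambda>n. \<Prod>k<n * 3. 1 + a * h ^ k) \<longlonglongrightarrow> qprod (h ^ 3) a * qprod (h ^ 3) (a * h) * qprod (h ^ 3) (a * h\<^sup>2)"
    using tendsto_mult[OF tendsto_mult[OF qprod_LIMSEQ[OF h3, of a] qprod_LIMSEQ[OF h3, of "a * h"]]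
        qprod_LIMSEQ[OF h3, of "a * h\<^sup>2"]] by simp
  moreover have "(\<lambda>n. \<Prod>k<n * 3. 1 + a * h ^ k) \<longlonglongrightarrow> qprod h a"
    using LIMSEQ_subseq_LIMSEQ[OF qprod_LIMSEQ[OF assms, of a], of "\<lambda>n. n * 3"]
    by (simp add: o_def strict_mono_def)
  ultimately show ?thesis
    using LIMSEQ_unique by blast
qed

lemma theta_chi_eq_qprod: "theta_chi q = qprod (q\<^sup>2) q"
  by (simp add: theta_chi_def qprod_def power_mult)

section \<open>The cubic equation\<close>

theorem theorem2p1:
  fixes q t :: complex
  assumes "norm q < 1" and "t ^ 9 = q"
  shows
    "theta_phi t / theta_phi (q ^ 9) = 1 + theta_u q t 1 + theta_u q t 2 + theta_u q t 3 + theta_u q t 4 \<and>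
     theta_p q t = 8 * t ^ 21 * theta_chi q / ((theta_chi (q ^ 9)) ^ 6 * theta_chi (q ^ 3)) \<and>
     theta_u q t 3 = theta_phi q / theta_phi (q ^ 9) - 1 \<and>
     (q \<noteq> 0 \<longrightarrow>
       (\<exists>\<alpha> \<beta> \<gamma>.
          (\<forall>\<xi>. theta_cubic q t \<xi> = (\<xi> - \<alpha>) * (\<xi> - \<beta>) * (\<xi> - \<gamma>)) \<and>
          \<alpha> \<noteq> 0 \<and> \<beta> \<noteq> 0 \<and> \<gamma> \<noteq> 0 \<and>
          (theta_u q t 1) ^ 3 = \<beta> * theta_p q t / \<alpha> \<and>
          (theta_u q t 2) ^ 3 = \<gamma> * theta_p q t / \<beta> \<and>
          (theta_u q t 4) ^ 3 = \<alpha> * theta_p q t / \<gamma>))"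
proof -
  have t: "norm t < 1"
    using assms power_less_one_iff[of "norm t" 9] by (auto simp: norm_power)
  have t3: "norm (t ^ 3) < 1"
    using t by (simp add: norm_power power_less_one_iff)
  have qn: "norm (q ^ n) < 1" if "0 < n" for n
    using assms(1) that by (simp add: norm_power power_less_one_iff)
  have tq: "q ^ n = t ^ (9 * n)" for n
    unfolding assms(2) [symmetric] by (simp add: power_mult)

  \<comment> \<open>Dissection of the theta functions modulo 9\<close>
  define T where "T = (\<lambda>i. square_theta t {m. m mod 9 = i})"
  have T_eq: "square_theta t {m. m mod 9 = i} = T i" for i
    by (simp add: T_def)
  have T_symm: "T 5 = T 4" "T 6 = T 3" "T 7 = T 2" "T 8 = T 1"
    using square_theta_uminus[of t 9 4] square_theta_uminus[of t 9 3]
      square_theta_uminus[of t 9 2] square_theta_uminus[of t 9 1]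
    unfolding T_def by simp_all
  have T_theta: "T (int k) = t ^ (k\<^sup>2) * theta_f (q ^ (9 + 2 * k)) (q ^ (9 - 2 * k))" if "k \<le> 4" for k
  proof -
    have "9\<^sup>2 + 2 * k * 9 = 9 * (9 + 2 * k)" "9\<^sup>2 - 2 * k * 9 = 9 * (9 - 2 * k)"
      using that by simp_all
    moreover have "int k mod 9 = int k"
      using that by simp
    ultimately show ?thesis
      unfolding T_def tq using square_theta_residue[of 9 k t] that by simp
  qed
  have phi9: "theta_phi (q ^ 9) = T 0"
    using T_theta[of 0] by (simp add: theta_phi_def)
  have u: "theta_u q t k = 2 * T (int k) / T 0" if "k \<le> 4" for k
    using T_theta[OF that] by (simp add: theta_u_def phi9)
  have phit: "theta_phi t = T 0 + 2 * T 1 + 2 * T 2 + 2 * T 3 + 2 * T 4"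
  proof -
    \<comment> \<open>Modulus 1 expresses the full series as a residue class.\<close>
    have "theta_phi t = square_theta t {m. m mod 1 = 0}"
      using square_theta_residue[of 1 0 t] by (simp add: theta_phi_def)
    also have "{m::int. m mod 1 = 0} = {m. m mod 9 \<in> {0,1,2,3,4,5,6,7,8}}"
    proof -
      have "m mod 9 \<in> {0,1,2,3,4,5,6,7,8}" for m :: int
        unfolding insert_iff empty_iff by presburger
      thus ?thesis
        by simp
    qed
    also have "square_theta t \<dots> = (\<Sum>i\<in>{0,1,2,3,4,5,6,7,8}. T i)"
      unfolding T_def by (rule square_theta_fibres[OF t]) simp
    also have "\<dots> = T 0 + 2 * T 1 + 2 * T 2 + 2 * T 3 + 2 * T 4"
      using T_symm by simp
    finally show ?thesis .
  qed
  have phiq: "theta_phi q = T 0 + 2 * T 3"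
  proof -
    \<comment> \<open>With \<open>q = t ^ 9\<close> the exponent \<open>9 n^2\<close> is the square
      of \<open>3 n\<close>.\<close>
    have "theta_phi q = square_theta t {m. m mod 3 = 0}"
      using square_theta_residue[of 3 0 t] assms(2) by (simp add: theta_phi_def)
    also have "{m::int. m mod 3 = 0} = {m. m mod 9 \<in> {0,3,6}}"
      unfolding insert_iff empty_iff by (rule Collect_cong) presburger
    also have "square_theta t \<dots> = (\<Sum>i\<in>{0,3,6}. T i)"
      unfolding T_def by (rule square_theta_fibres[OF t]) simp
    also have "\<dots> = T 0 + 2 * T 3"
      using T_symm by simp
    finally show ?thesis .
  qed

  \<comment> \<open>The three cubic sums\<close>
  define Z where "Z = square_theta (t ^ 3) {n. n mod 3 = 0}"
  define Y where "Y = square_theta (t ^ 3) {n. n mod 3 = 1}"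
  have Y2: "square_theta (t ^ 3) {n. n mod 3 = 2} = Y"
    using square_theta_uminus[of "t ^ 3" 3 1] by (simp add: Y_def)
  \<comment> \<open>For \<open>c = 0, 1, 2\<close> the classes \<open>c, c+3, c+6, c+9\<close> fold
    under the sign symmetry to 0,3,3,0 and 1,4,2,1 and 2,4,1,2. The mean has class
    \<open>c + 1\<close> modulo 3, giving \<open>Y\<close>, \<open>Y\<close>,
    \<open>Z\<close>.\<close>
  have E0: "T 3 * (T 3 ^ 2 + T 3 * T 0 + T 0 ^ 2) = Y * hexagonal_theta t"
    using cubic_theta_sum[OF t, of 0] T_symm
    by (simp add: T_eq Y_def algebra_simps power2_eq_square)
  have E1: "T 2 * T 4 ^ 2 + T 1 ^ 2 * T 4 + T 1 * T 2 ^ 2 = Y * hexagonal_theta t"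
    using cubic_theta_sum[OF t, of 1] T_symm
    by (simp add: T_eq Y2 algebra_simps power2_eq_square)
  have E2: "T 1 ^ 2 * T 2 + T 4 ^ 2 * T 1 + T 2 ^ 2 * T 4 = Z * hexagonal_theta t"
    using cubic_theta_sum[OF t, of 2] T_symm
    by (simp add: T_eq Z_def algebra_simps power2_eq_square)

  \<comment> \<open>Product formulas over the common base \<open>q ^ 18\<close>\<close>
  define R where "R = (\<lambda>r. qprod (q ^ 18) (q ^ r))"
  define A where "A = euler (q ^ 18)"
  define B where "B = euler (q ^ 6)"
  have R_nz: "R r \<noteq> 0" if "0 < r" for r
    unfolding R_def using qn that by (intro qprod_nonzero) auto
  have A_nz: "A \<noteq> 0"
    unfolding A_def using qn by (auto intro!: euler_nonzero)
  have T_prod: "T (int k) = t ^ (k\<^sup>2) * (R (9 + 2 * k) * R (9 - 2 * k) * A)" if "k \<le> 4" for k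
  proof -
    have "q ^ (9 + 2 * k) * q ^ (9 - 2 * k) = q ^ 18"
      using that by (simp add: power_add [symmetric])
    thus ?thesis
      using that qn[of 18] by (simp add: T_theta jacobi_triple_product R_def A_def)
  qed
  have T0: "T 0 = R 9 ^ 2 * A"
    using T_prod[of 0] by (simp add: power2_eq_square)
  have T1: "T 1 = t * (R 11 * R 7 * A)"
    using T_prod[of 1] by simp
  have T2: "T 2 = t ^ 4 * (R 13 * R 5 * A)"
    using T_prod[of 2] by simp
  have T3: "T 3 = t ^ 9 * (R 15 * R 3 * A)"
    using T_prod[of 3] by simp
  have T4: "T 4 = t ^ 16 * (R 17 * R 1 * A)"
    using T_prod[of 4] by simp
  \<comment> \<open>From here on every quantity is a monomial in \<open>t\<close>, the
    \<open>R r\<close> with odd \<open>r\<close>, and the Euler products, so the product identities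
    reduce to comparing exponents.\<close>
  have R6: "qprod (q ^ 6) (q ^ r) = R r * R (r + 6) * R (r + 12)" for r
    using qprod_trisect[OF qn[of 6], of "q ^ r"]
    by (simp add: R_def power_add [symmetric] power_mult [symmetric])
  have Z: "Z = (R 3 * R 9 * R 15) ^ 2 * B"
  proof -
    have "Z = theta_f (q ^ 3) (q ^ 3)"
      using square_theta_residue[of 3 0 "t ^ 3"] by (simp add: Z_def tq power_mult [symmetric])
    also have "\<dots> = qprod (q ^ 6) (q ^ 3) * qprod (q ^ 6) (q ^ 3) * B"
      using jacobi_triple_product[of "q ^ 3" "q ^ 3"] qn[of 6]
      by (simp add: B_def power_add [symmetric])
    finally show ?thesis
      using R6[of 3] by (simp add: power2_eq_square)
  qed
  have Y: "Y = t ^ 3 * (R 1 * R 5 * R 7 * R 11 * R 13 * R 17 * B)"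
  proof -
    have "Y = t ^ 3 * theta_f (q ^ 5) (q ^ 1)"
      using square_theta_residue[of 3 1 "t ^ 3"] unfolding Y_def tq by (simp add: power_mult [symmetric])
    also have "theta_f (q ^ 5) (q ^ 1) = qprod (q ^ 6) (q ^ 5) * qprod (q ^ 6) (q ^ 1) * B"
    proof -
      have "q ^ 5 * q ^ 1 = q ^ 6"
        using power_add[of q 5 1] by simp
      thus ?thesis
        using jacobi_triple_product[of "q ^ 5" "q ^ 1"] qn[of 6] by (simp only: B_def zero_less_numeral)
    qed
    finally show ?thesis
      using R6[of 5] R6[of 1] by (simp del: power_one_right)
  qed
  have chi1: "theta_chi q = R 1 * R 3 * R 5 * R 7 * R 9 * R 11 * R 13 * R 15 * R 17"
  proof -
    have "theta_chi q = qprod (q ^ 6) (q ^ 1) * qprod (q ^ 6) (q ^ 3) * qprod (q ^ 6) (q ^ 5)"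
      using qprod_trisect[OF qn[of 2], of q]
      by (simp add: theta_chi_eq_qprod power_mult [symmetric] power_Suc [symmetric] del: power_Suc)
    thus ?thesis
      using R6[of 1] R6[of 3] R6[of 5] by (simp del: power_one_right)
  qed
  have chi3: "theta_chi (q ^ 3) = R 3 * R 9 * R 15"
    using R6[of 3] by (simp add: theta_chi_eq_qprod power_mult [symmetric])
  have chi9: "theta_chi (q ^ 9) = R 9"
    by (simp add: theta_chi_eq_qprod power_mult [symmetric] R_def)
  have T0_nz: "T 0 \<noteq> 0"
    unfolding T0 using R_nz A_nz by simp

  \<comment> \<open>The dissection, product and value formulas for the \<open>u\<close>
    functions\<close>
  have u1: "theta_u q t 1 = 2 * T 1 / T 0" and u2: "theta_u q t 2 = 2 * T 2 / T 0"
    and u3: "theta_u q t 3 = 2 * T 3 / T 0" and u4: "theta_u q t 4 = 2 * T 4 / T 0"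
    using u[of 1] u[of 2] u[of 3] u[of 4] by simp_all
  have p: "theta_p q t = 8 * (T 1 * T 2 * T 4) / T 0 ^ 3"
    unfolding theta_p_def u1 u2 u4 by (simp add: power3_eq_cube)

  have i: "theta_phi t / theta_phi (q ^ 9) = 1 + theta_u q t 1 + theta_u q t 2 + theta_u q t 3 + theta_u q t 4"
    unfolding phit phi9 u1 u2 u3 u4 using T0_nz by (simp add: add_divide_distrib)
  have iii: "theta_u q t 3 = theta_phi q / theta_phi (q ^ 9) - 1"
    using T0_nz by (simp add: phiq phi9 u3 add_divide_distrib)
  have ii: "theta_p q t = 8 * t ^ 21 * theta_chi q / ((theta_chi (q ^ 9)) ^ 6 * theta_chi (q ^ 3))"
  proof -
    \<comment> \<open>\<open>T 1 * T 2 * T 4\<close> carries \<open>t\<close> to the power 1 + 4 +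
      16 and the indices 1, 5, 7, 11, 13, 17; the factors \<open>R 3\<close>, \<open>R 9\<close>,
      \<open>R 15\<close> complete them to \<open>theta_chi q\<close>.\<close>
    have "T 1 * T 2 * T 4 * (R 9 ^ 6 * (R 3 * R 9 * R 15)) = t ^ 21 * theta_chi q * T 0 ^ 3"
      unfolding T0 T1 T2 T4 chi1 by algebra
    thus ?thesis
      unfolding p chi9 chi3 using T0_nz R_nz by (simp add: frac_eq_eq mult_ac)
  qed

  \<comment> \<open>The roots of the cubic\<close>
  have iv: "\<exists>\<alpha> \<beta> \<gamma>.
          (\<forall>\<xi>. theta_cubic q t \<xi> = (\<xi> - \<alpha>) * (\<xi> - \<beta>) * (\<xi> - \<gamma>)) \<and>
          \<alpha> \<noteq> 0 \<and> \<beta> \<noteq> 0 \<and> \<gamma> \<noteq> 0 \<and>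
          (theta_u q t 1) ^ 3 = \<beta> * theta_p q t / \<alpha> \<and>
          (theta_u q t 2) ^ 3 = \<gamma> * theta_p q t / \<beta> \<and>
          (theta_u q t 4) ^ 3 = \<alpha> * theta_p q t / \<gamma>" if "q \<noteq> 0"
  proof -
    define a b d s where "a = theta_u q t 1" and "b = theta_u q t 2" and "d = theta_u q t 4"
      and "s = theta_u q t 3"
    \<comment> \<open>The products \<open>R r\<close> and \<open>A\<close> do not vanish, so only
      the power of \<open>t\<close> could make \<open>T 1\<close>, \<open>T 2\<close> or
      \<open>T 4\<close> zero.\<close>
    have "t \<noteq> 0"
      using that assms(2) by auto
    hence nz: "a \<noteq> 0" "b \<noteq> 0" "d \<noteq> 0"
      unfolding a_def b_def d_def u1 u2 u4 T1 T2 T4 using R_nz A_nz T0_nz by simp_all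
    have G: "T 2 * T 4 ^ 2 + T 1 ^ 2 * T 4 + T 1 * T 2 ^ 2 = T 3 * (T 3 ^ 2 + T 3 * T 0 + T 0 ^ 2)"
      using E0 E1 by simp
    \<comment> \<open>Both sides are \<open>t ^ 21 * A ^ 3 * B\<close> times the square of
      \<open>R 3 * R 9 * R 15\<close> and the six \<open>R r\<close> with \<open>r\<close> prime to
      6.\<close>
    have TZ: "T 1 * T 2 * T 4 * Z = T 0 * T 3 ^ 2 * Y"
      unfolding T0 T1 T2 T3 T4 Z Y by algebra
    have F: "T 1 * T 2 * T 4 * (T 1 ^ 2 * T 2 + T 4 ^ 2 * T 1 + T 2 ^ 2 * T 4) =
        T 0 * T 3 ^ 2 * (T 3 * (T 3 ^ 2 + T 3 * T 0 + T 0 ^ 2))"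
      unfolding E0 E2 using TZ by algebra
    define S where "S = s * ((theta_phi q)\<^sup>2 / (theta_phi (q ^ 9))\<^sup>2 + 3)"
    \<comment> \<open>As \<open>theta_phi q / theta_phi (q ^ 9)\<close> is \<open>1 + s\<close>,
      \<open>S\<close> is \<open>s * (s^2 + 2 * s + 4)\<close> with
      \<open>s = 2 * T 3 / T 0\<close>.\<close>
    have S: "S = 8 * (T 3 * (T 3 ^ 2 + T 3 * T 0 + T 0 ^ 2)) / T 0 ^ 3"
      unfolding S_def s_def u3 phiq phi9 using T0_nz by (simp add: field_simps power2_eq_square power3_eq_cube)
    have e1: "b * d ^ 2 + a ^ 2 * d + a * b ^ 2 = S"
      unfolding S G [symmetric] a_def b_def d_def u1 u2 u4 using T0_nz
      by (simp add: field_simps power2_eq_square power3_eq_cube)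
    \<comment> \<open>The left side is the second elementary symmetric function of
      \<open>b * d ^ 2\<close>, \<open>a ^ 2 * d\<close>, \<open>a * b ^ 2\<close>;
      \<open>e1\<close> treats the first, and their product is
      \<open>(a * b * d) ^ 3\<close>.\<close>
    have "a * b * d * (a ^ 2 * b + d ^ 2 * a + b ^ 2 * d) =
        64 * (T 1 * T 2 * T 4 * (T 1 ^ 2 * T 2 + T 4 ^ 2 * T 1 + T 2 ^ 2 * T 4)) / T 0 ^ 6"
      unfolding a_def b_def d_def u1 u2 u4 using T0_nz
      by (simp add: field_simps power2_eq_square eval_nat_numeral)
    also have "\<dots> = 2 * s ^ 2 * S"
      unfolding F S s_def u3 using T0_nz by (simp add: field_simps power2_eq_square eval_nat_numeral)
    finally have e2: "a * b * d * (a ^ 2 * b + d ^ 2 * a + b ^ 2 * d) = 2 * s ^ 2 * S" .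
    have P: "theta_p q t = a * b * d"
      by (simp add: theta_p_def a_def b_def d_def)
    have "theta_cubic q t \<xi> = (\<xi> - b * d ^ 2) * (\<xi> - a ^ 2 * d) * (\<xi> - a * b ^ 2)" for \<xi>
    proof -
      have "theta_cubic q t \<xi> = \<xi> ^ 3 - S * \<xi> ^ 2 + 2 * s ^ 2 * S * \<xi> - (a * b * d) ^ 3"
        unfolding theta_cubic_def P S_def s_def by algebra
      also have "\<dots> = (\<xi> - b * d ^ 2) * (\<xi> - a ^ 2 * d) * (\<xi> - a * b ^ 2)"
        \<comment> \<open>\<open>S\<close> gets expanded by \<open>e1\<close>, so \<open>e2\<close>
          must carry the same expansion to match the linear coefficient.\<close>
        unfolding e1 [symmetric] e2 [symmetric, unfolded e1 [symmetric]] by algebra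
      finally show ?thesis .
    qed
    \<comment> \<open>The roots are chosen so that each of these quotients, multiplied by
      \<open>a * b * d\<close>, is a perfect cube.\<close>
    moreover have "a ^ 3 = (a ^ 2 * d) * theta_p q t / (b * d ^ 2)"
      "b ^ 3 = (a * b ^ 2) * theta_p q t / (a ^ 2 * d)"
      "d ^ 3 = (b * d ^ 2) * theta_p q t / (a * b ^ 2)"
      unfolding P using nz by (simp_all add: field_simps power2_eq_square power3_eq_cube)
    moreover have "b * d ^ 2 \<noteq> 0" "a ^ 2 * d \<noteq> 0" "a * b ^ 2 \<noteq> 0"
      using nz by simp_all
    ultimately show ?thesis
      unfolding a_def b_def d_def by blast
  qed
  from i ii iii iv show ?thesis
    by blast
qed

end
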